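(* Let $A$ be a positive rational number and let $n \ge 2$ be a natural number. If $\sqrt[n]{A}$ is irreducible, then $\sqrt[n]{A}$ is not a root of any nonzero polynomial $p(x)$ with rational coefficients of degree less than $n$.
   Context: Natural numbers are the positive integers, and $\sqrt[n]{A}$ denotes the positive real $n$-th root. For a positive rational number $A$ and a natural number $n \ge 2$, the radical $\sqrt[n]{A}$ is called irreducible if there do not exist a natural number $m < n$ (with $m=1$ allowed, $\sqrt[1]{B}=B$) and a positive rational number $B$ such that $\sqrt[n]{A} = \sqrt[m]{B}$. *)

theory Defs
  imports Complex_Main "HOL-Computational_Algebra.Polynomial"
begin

text \<open>Irreducibility depends on the pair of index and radicand, not only on the real value of the
  radical. The predicate is meant for \<open>n \<ge> 2\<close> and \<open>A > 0\<close>; \<^term>\<open>root n x\<close> is then the positive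
  real root. The index \<open>m = 0\<close> has to be excluded explicitly.\<close>

definition irreducible_radical :: "nat \<Rightarrow> rat \<Rightarrow> bool" where
  "irreducible_radical n A \<longleftrightarrow>
     \<not> (\<exists>(m::nat) (B::rat). 1 \<le> m \<and> m < n \<and> 0 < B \<and>
          root n (of_rat A) = root m (of_rat B))"

end

theory Submission
  imports Defs "HOL-Computational_Algebra.Fundamental_Theorem_Algebra"
begin

text \<open>A nonzero rational polynomial \<open>q\<close> of least degree \<open>d\<close> vanishing at \<open>r = root n A\<close> divides
  \<open>x ^ n - A\<close>, so every complex root of \<open>q\<close> has absolute value \<open>r\<close>. By Vieta, \<open>r ^ d\<close> is the absolute
  value of the quotient of the constant and the leading coefficient of \<open>q\<close>, a positive rational \<open>B\<close>.
  Hence \<open>r = root d B\<close> with \<open>d \<ge> 1\<close>, and irreducibility gives \<open>d \<ge> n\<close>.\<close>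

text \<open>Over the complex numbers \<open>p\<close> splits into linear factors. Evaluating at 0
  gives the leading coefficient times the product of the negated roots, and each of these
  \<open>degree p\<close> factors has norm \<open>r\<close>.\<close>

lemma norm_coeff_0_if_roots_same_norm:
  fixes p :: "complex poly"
  assumes "\<And>z. poly p z = 0 \<Longrightarrow> norm z = r"
  shows "norm (coeff p 0) = norm (lead_coeff p) * r ^ degree p"
proof (cases "p = 0")
  case False
  then obtain A where A: "size A = degree p"
      "p = smult (lead_coeff p) (\<Prod>x\<in>#A. [:-x, 1:])"
    using alg_closed_imp_factorization by blast
  have poly_p: "poly p y = lead_coeff p * (\<Prod>x\<in>#A. y - x)" for y
    by (subst A(2)) (simp add: poly_prod_mset)
  have roots: "norm x = r" if "x \<in># A" for x
    using that assms[of x] by (auto simp: poly_p)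
  have "norm (\<Prod>x\<in>#A. 0 - x) = r ^ size A"
    using roots by (induction A) (auto simp: norm_mult)
  then show ?thesis
    using A(1) by (simp add: poly_p norm_mult flip: poly_0_coeff_0)
qed simp

lemma norm_of_rat:
  "norm (of_rat a :: 'a :: {field_char_0, real_normed_field}) = \<bar>of_rat a\<bar>"
  by (cases a) (simp add: of_rat_rat norm_divide)

lemma map_poly_of_rat_mult:
  "map_poly of_rat (p * q) = (map_poly of_rat p * map_poly of_rat q :: 'a :: field_char_0 poly)"
  by (rule poly_eqI) (simp add: coeff_map_poly coeff_mult of_rat_sum of_rat_mult)

lemma map_poly_of_rat_add:
  "map_poly of_rat (p + q) = (map_poly of_rat p + map_poly of_rat q :: 'a :: field_char_0 poly)"
  by (rule poly_eqI) (simp add: coeff_map_poly of_rat_add)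

lemma poly_map_poly_of_rat_monom_diff:
  "poly (map_poly of_rat (monom 1 n - [:A:])) z = (z ^ n - of_rat A :: 'a :: field_char_0)"
proof -
  have "map_poly of_rat (monom 1 n - [:A:]) = (monom 1 n - [:of_rat A:] :: 'a poly)"
    by (rule poly_eqI) (simp add: coeff_map_poly of_rat_diff coeff_pCons split: nat.split)
  then show ?thesis
    by (simp add: poly_monom)
qed

text \<open>Choose \<open>q\<close> of least degree among the nonzero polynomials vanishing at
  \<open>x\<close>; division with remainder then gives divisibility. The degree bound lets
  \<open>q\<close> inherit the bound on \<open>degree p\<close> in the theorem.\<close>

lemma rat_minimal_poly_exists:
  fixes x :: "'a :: field_char_0"
  assumes "p \<noteq> 0" and "poly (map_poly of_rat p) x = 0"
  obtains q :: "rat poly" where "q \<noteq> 0" "poly (map_poly of_rat q) x = 0" "degree q \<le> degree p"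
    "\<And>f. poly (map_poly of_rat f) x = 0 \<Longrightarrow> q dvd f"
proof -
  define P where "P q \<longleftrightarrow> q \<noteq> 0 \<and> poly (map_poly of_rat q) x = 0" for q :: "rat poly"
  have "P p"
    using assms by (simp add: P_def)
  then obtain q where q: "P q" and least: "\<And>f. P f \<Longrightarrow> degree q \<le> degree f"
    using ex_has_least_nat[of P p degree] by blast
  have "q dvd f" if "poly (map_poly of_rat f) x = 0" for f
  proof -
    \<comment> \<open>Writing \<open>f\<close> in this form shows that the remainder vanishes at
      \<open>x\<close> too, as \<open>q\<close> does. Its degree would be below that of
      \<open>q\<close>, so minimality forces it to be 0.\<close>
    have "poly (map_poly of_rat (q * (f div q) + f mod q)) x = 0"
      using that by simp
    then have "poly (map_poly of_rat (f mod q)) x = 0"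
      using q unfolding map_poly_of_rat_add map_poly_of_rat_mult by (simp add: P_def)
    then have "f mod q = 0"
      using q least[of "f mod q"] degree_mod_less[of q f] unfolding P_def by (meson not_less)
    then show ?thesis
      by (simp add: mod_eq_0_iff_dvd)
  qed
  with that q least[OF \<open>P p\<close>] show thesis
    by (auto simp: P_def)
qed

theorem theorem2p1:
  fixes A :: rat and n :: nat
  assumes "A > 0" and "n \<ge> 2"
    and "irreducible_radical n A"
  shows "\<not> (\<exists>p :: rat poly. p \<noteq> 0 \<and> degree p < n \<and>
              poly (map_poly of_rat p) (root n (of_rat A)) = 0)"
proof
  define r :: real where "r = root n (of_rat A)"
  have r: "r > 0" "r ^ n = of_rat A"
    using assms by (simp_all add: r_def)
  assume "\<exists>p :: rat poly. p \<noteq> 0 \<and> degree p < n \<and>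
            poly (map_poly of_rat p) (root n (of_rat A)) = 0"
  then obtain p where p: "p \<noteq> 0" "degree p < n" "poly (map_poly of_rat p) r = 0"
    unfolding r_def by blast
  obtain q where q: "q \<noteq> 0" "poly (map_poly of_rat q) r = 0" "degree q \<le> degree p"
    and dvd: "\<And>f. poly (map_poly of_rat f) r = 0 \<Longrightarrow> q dvd f"
    using rat_minimal_poly_exists[OF p(1,3)] by metis
  have "q dvd monom 1 n - [:A:]"
    by (rule dvd) (simp add: poly_map_poly_of_rat_monom_diff r)
  \<comment> \<open>This factorization was found through the real number \<open>r\<close>, but it
    holds over the rationals and so can be evaluated at complex points.\<close>
  then obtain s where s: "monom 1 n - [:A:] = q * s" ..
  have "norm z = r" if "poly (map_poly of_rat q) z = 0" for z :: complex
  proof -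
    have "z ^ n = of_rat A"
      using that poly_map_poly_of_rat_monom_diff[of n A z] by (simp add: s map_poly_of_rat_mult)
    then have "norm z ^ n = norm (of_rat A :: complex)"
      by (simp flip: norm_power)
    also have "\<dots> = r ^ n"
      using assms(1) r(2) by (simp add: norm_of_rat)
    finally show ?thesis
      using assms(2) r(1) by (simp add: power_eq_iff_eq_base)
  qed
  then have coeffs: "of_rat \<bar>coeff q 0\<bar> = of_rat \<bar>lead_coeff q\<bar> * r ^ degree q"
    using norm_coeff_0_if_roots_same_norm[of "map_poly of_rat q" r]
    by (simp add: coeff_map_poly degree_map_poly norm_of_rat)
  define B where "B = \<bar>coeff q 0 / lead_coeff q\<bar>"
  have B: "of_rat B = r ^ degree q"
    using coeffs q(1) by (simp add: B_def abs_divide of_rat_divide)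
  \<comment> \<open>Positivity comes from \<open>r ^ degree q\<close>, so \<open>coeff q 0\<close>
    needs no separate argument.\<close>
  have "B > 0"
  proof -
    have "(0 :: real) < of_rat B"
      using r(1) by (simp add: B)
    then show ?thesis
      by simp
  qed
  \<comment> \<open>A nonzero constant has no root. This makes \<open>degree q\<close> an admissible
    index \<open>m\<close>, and with index 0 \<open>root\<close> would return 0 instead of
    \<open>r\<close>.\<close>
  have deg: "degree q > 0"
  proof (rule gr0I)
    assume "degree q = 0"
    then obtain c where "q = [:c:]"
      by (rule degree_eq_zeroE)
    with q(1,2) show False
      by (simp add: map_poly_pCons)
  qed
  have "root n (of_rat A) = root (degree q) (of_rat B)"
    using deg r(1) by (simp add: B real_root_power_cancel flip: r_def)
  moreover have "1 \<le> degree q" "degree q < n"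
    using deg p(2) q(3) by simp_all
  ultimately show False
    using assms(3) \<open>B > 0\<close> unfolding irreducible_radical_def by blast
qed

end
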